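(* Let $p$ be a prime and let $A,B\subseteq\mathbb{Z}/p\mathbb{Z}$ be non-empty. If $|A|<p/2$ and $|B|<\sqrt{|A|}+1$, then for every mapping $\tau\colon B\to A$ we have $|A\stackrel{\tau}{+}B|\ge |A|+|B|-3$.
   Context: $\mathbb{Z}/p\mathbb{Z}$ is the cyclic group of prime order $p$. For a mapping $\tau\colon B\to A$, the restricted sumset is $A\stackrel{\tau}{+}B:=\{a+b: a\in A,\ b\in B,\ a\ne\tau(b)\}$. *)

theory Defs
  imports Complex_Main "HOL-Library.FuncSet" "Berlekamp_Zassenhaus.Finite_Field"
begin

definition restricted_sumset ::
  "'a::plus set \<Rightarrow> ('a \<Rightarrow> 'a) \<Rightarrow> 'a set \<Rightarrow> 'a set" where
  "restricted_sumset A \<tau> B = {a + b |a b. a \<in> A \<and> b \<in> B \<and> a \<noteq> \<tau> b}"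

end

theory Submission
  imports Defs
begin

text \<open>
  Let \<open>S\<close> be the restricted sumset, \<open>k = |B|\<close>, and let \<open>shift A d\<close> be the size of
  \<open>(A + d) - A\<close>, a subadditive function of \<open>d\<close>. Each translate \<open>A + b\<close> with \<open>b \<in> B\<close> lies in
  \<open>S\<close> up to one point, so \<open>|S| \<le> |A| + k - 4\<close> forces \<open>shift A d \<le> t\<close> for all
  \<open>d \<in> B - B\<close>, where \<open>t = k - 2\<close>. By Cauchy--Davenport and subadditivity, at least
  \<open>2 (t + 1) j + 1\<close> elements \<open>d\<close> satisfy \<open>shift A d \<le> j t\<close>, for every \<open>j \<le> t\<close>.
  On the other hand, Pollard's theorem for \<open>A\<close> and \<open>- A\<close> bounds the sum of the positive
  parts of \<open>s - shift A d\<close> by \<open>s\<^sup>2\<close>, as if \<open>A\<close> were an interval. For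
  \<open>s = t (t + 1) < |A|\<close> the two estimates contradict each other.
\<close>

section \<open>Representation counts and the Dyson transform\<close>

definition reps :: "'a::ab_group_add set \<Rightarrow> 'a set \<Rightarrow> 'a \<Rightarrow> nat" where
  "reps A B x = card {v \<in> B. x - v \<in> A}"

definition shift :: "'a::ab_group_add set \<Rightarrow> 'a \<Rightarrow> nat" where
  "shift A d = card {u \<in> A. u + d \<notin> A}"

lemma reps_le_card: "finite B \<Longrightarrow> reps A B x \<le> card B"
  unfolding reps_def by (auto intro: card_mono)

lemma sum_reps:
  fixes A B :: "'a::{ab_group_add,finite} set"
  shows "(\<Sum>x\<in>UNIV. reps A B x) = card A * card B"
proof -
  have "(\<Sum>x\<in>UNIV. reps A B x) = (\<Sum>x\<in>UNIV. \<Sum>v\<in>B. if x - v \<in> A then 1 else 0)"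
    unfolding reps_def by (simp add: sum.If_cases Int_def)
  also have "\<dots> = (\<Sum>v\<in>B. \<Sum>x\<in>UNIV. if x - v \<in> A then 1 else 0)"
    by (rule sum.swap)
  also have "\<dots> = (\<Sum>v\<in>B. card A)"
  proof (rule sum.cong[OF refl])
    fix v
    have "card {x. x - v \<in> A} = card A"
      by (rule bij_betw_same_card[where f="\<lambda>x. x - v"],
          rule bij_betw_byWitness[where f'="\<lambda>x. x + v"]) auto
    then show "(\<Sum>x\<in>UNIV. if x - v \<in> A then 1 else 0) = card A"
      by (simp add: sum.If_cases)
  qed
  finally show ?thesis by simp
qed

lemma reps_translate: "reps A ((+) g ` B) x = reps A B (x - g)"
  unfolding reps_def
  by (rule bij_betw_same_card[where f="\<lambda>v. v - g"],
      rule bij_betw_byWitness[where f'="\<lambda>v. g + v"])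
     (auto simp: algebra_simps)

lemma sum_min_reps_translate:
  fixes A B :: "'a::{ab_group_add,finite} set"
  shows "(\<Sum>x\<in>UNIV. min t (reps A ((+) g ` B) x)) = (\<Sum>x\<in>UNIV. min t (reps A B x))"
  unfolding reps_translate
  by (rule sum.reindex_bij_witness[where i="\<lambda>x. x + g" and j="\<lambda>x. x - g"]) auto

text \<open>Sort the representations \<open>x = u + v\<close> by where \<open>u\<close> and
  \<open>v\<close> lie. Exchanging the two summands carries those with \<open>v\<close> in
  \<open>B - A\<close> and \<open>u\<close> in \<open>A \<inter> B\<close> (\<open>Q\<close>) to
  those with \<open>v\<close> in \<open>A \<inter> B\<close> and \<open>u\<close> in
  \<open>B - A\<close> (\<open>Q'\<close>); the other classes agree on both sides.\<close>

lemma reps_dyson_transform: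
  fixes A B :: "'a::ab_group_add set"
  assumes "finite A" "finite B"
  shows "reps A B x = reps (A \<union> B) (A \<inter> B) x + reps (A - B) (B - A) x"
proof -
  define P where "P = {v \<in> A \<inter> B. x - v \<in> A}"
  define Q where "Q = {v \<in> B - A. x - v \<in> A \<inter> B}"
  define Q' where "Q' = {v \<in> A \<inter> B. x - v \<in> B - A}"
  define R where "R = {v \<in> B - A. x - v \<in> A - B}"
  have fin: "finite P" "finite Q" "finite Q'" "finite R"
    using assms unfolding P_def Q_def Q'_def R_def by auto
  have "card Q = card Q'"
    by (rule bij_betw_same_card[where f="\<lambda>v. x - v"],
        rule bij_betw_byWitness[where f'="\<lambda>v. x - v"])
       (auto simp: Q_def Q'_def)
  moreover have "reps A B x = card (P \<union> (Q \<union> R))"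
    unfolding reps_def by (rule arg_cong[where f=card]) (auto simp: P_def Q_def R_def)
  moreover have "\<dots> = card P + (card Q + card R)"
    using fin by (subst card_Un_disjoint; (subst card_Un_disjoint)?) (auto simp: P_def Q_def R_def)
  moreover have "reps (A \<union> B) (A \<inter> B) x = card (P \<union> Q')"
    unfolding reps_def by (rule arg_cong[where f=card]) (auto simp: P_def Q'_def)
  moreover have "\<dots> = card P + card Q'"
    using fin by (subst card_Un_disjoint) (auto simp: P_def Q'_def)
  moreover have "reps (A - B) (B - A) x = card R"
    by (simp add: reps_def R_def)
  ultimately show ?thesis by simp
qed

section \<open>Pollard's theorem and Cauchy--Davenport modulo a prime\<close>

lemma mod_ring_translation_invariant:
  fixes A :: "'p::prime_card mod_ring set"
  assumes "A \<noteq> {}" "d \<noteq> 0" "\<And>x. x \<in> A \<Longrightarrow> x + d \<in> A"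
  shows "A = UNIV"
proof -
  obtain a where a: "a \<in> A" using assms(1) by auto
  have step: "a + of_nat n * d \<in> A" for n
  proof (induction n)
    case (Suc n)
    then show ?case using assms(3)[of "a + of_nat n * d"] by (simp add: algebra_simps)
  qed (use a in simp)
  have "y \<in> A" for y
  proof -
    obtain n where "(y - a) / d = of_nat n" using surj_of_nat_mod_ring by blast
    then have "a + of_nat n * d = y" using assms(2) by (metis nonzero_divide_eq_eq add_diff_cancel_left' diff_add_cancel add.commute)
    then show ?thesis using step by metis
  qed
  then show ?thesis by auto
qed

text \<open>Provides the translate of \<open>B\<close> whose intersection with \<open>A\<close> is
  non-empty but smaller than \<open>B\<close>, so that both pairs of the Dyson transform have a
  smaller second set. If every translate meeting \<open>A\<close> lay inside \<open>A\<close>, then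
  \<open>A\<close> would be stable under a nonzero difference of elements of
  \<open>B\<close>.\<close>

lemma exists_splitting_translate:
  fixes A B :: "'p::prime_card mod_ring set"
  assumes "A \<noteq> {}" "A \<noteq> UNIV" "card B \<ge> 2"
  shows "\<exists>g. A \<inter> (+) g ` B \<noteq> {} \<and> \<not> (+) g ` B \<subseteq> A"
proof (rule ccontr)
  assume none: "\<not> ?thesis"
  obtain b c where bc: "b \<in> B" "c \<in> B" "b \<noteq> c"
    using assms(3) card_2_iff' by (metis card_le_Suc0_iff_eq card.infinite
        not_less_eq_eq numeral_2_eq_2 zero_le)
  have "x + (c - b) \<in> A" if "x \<in> A" for x
  proof -
    have "x \<in> A \<inter> (+) (x - b) ` B"
      using that bc(1) by (auto intro!: image_eqI[of _ _ b])
    then have "(+) (x - b) ` B \<subseteq> A" using none by blast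
    moreover have "x + (c - b) \<in> (+) (x - b) ` B"
      using bc(2) by (auto intro!: image_eqI[of _ _ c])
    ultimately show ?thesis by blast
  qed
  then have "A = UNIV"
    using mod_ring_translation_invariant[of A "c - b"] assms(1) bc(3) by auto
  then show False using assms(2) by simp
qed

text \<open>Induction on \<open>card B\<close> by the Dyson transform. If \<open>t\<close> is at
  most the size \<open>i\<close> of the intersection, the union-intersection pair suffices;
  otherwise the truncation level is split as \<open>i + (t - i)\<close> between the two
  pairs.\<close>

theorem pollard:
  fixes A B :: "'p::prime_card mod_ring set"
  assumes "t \<le> card A" "t \<le> card B" "card A + card B \<le> CARD('p) + t"
  shows "t * (card A + card B - t) \<le> (\<Sum>x\<in>UNIV. min t (reps A B x))"
  using assms
proof (induction "card B" arbitrary: A B t rule: less_induct)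
  case less
  \<comment> \<open>Truncating at \<open>card Y\<close> changes nothing, so this is the total number
    of pairs.\<close>
  have full: "card X * card Y \<le> (\<Sum>x\<in>UNIV. min (card Y) (reps X Y x))"
    for X Y :: "'p mod_ring set"
    using sum_reps[of X Y] reps_le_card[of Y X] by (simp add: min_absorb2)
  consider "t = 0" | "t = card B" | "0 < t" "t < card B"
    using less.prems by linarith
  then show ?case
  proof cases
    case 1
    then show ?thesis by simp
  next
    case 2
    then show ?thesis using full[of A B] by (simp add: mult.commute)
  next
    case 3
    have "A \<noteq> {}" using 3 less.prems by auto
    \<comment> \<open>Otherwise \<open>card A + card B \<le> CARD('p) + t\<close> would force
      \<open>card B \<le> t\<close>.\<close>
    moreover have "A \<noteq> UNIV"
      using 3 less.prems by auto
    ultimately obtain g where g: "A \<inter> (+) g ` B \<noteq> {}" "\<not> (+) g ` B \<subseteq> A"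
      using exists_splitting_translate[of A B] 3 by auto
    define C where "C = (+) g ` B"
    have cC: "card C = card B" unfolding C_def by (simp add: card_image)
    define i where "i = card (A \<inter> C)"
    have i0: "0 < i" using g unfolding i_def C_def by (simp add: card_gt_0_iff)
    have iC: "i < card B" unfolding i_def cC[symmetric]
      using g by (intro psubset_card_mono) (auto simp: C_def)
    have iA: "i \<le> card A" unfolding i_def by (intro card_mono) auto
    have cU: "card (A \<union> C) + i = card A + card B"
      unfolding i_def cC[symmetric] by (rule card_Un_Int[symmetric]) auto
    have cA: "card (A - C) = card A - i"
      unfolding i_def by (simp add: card_Diff_subset_Int)
    have cB: "card (C - A) = card B - i"
      unfolding i_def cC[symmetric] by (simp add: card_Diff_subset_Int Int_commute)
    have "t * (card A + card B - t) \<le> (\<Sum>x\<in>UNIV. min t (reps A C x))"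
    proof (cases "t \<le> i")
      case True
      have "t * (card (A \<union> C) + card (A \<inter> C) - t)
          \<le> (\<Sum>x\<in>UNIV. min t (reps (A \<union> C) (A \<inter> C) x))"
        using True iC iA cU less.prems by (intro less.hyps) (auto simp: i_def)
      also have "\<dots> \<le> (\<Sum>x\<in>UNIV. min t (reps A C x))"
        by (intro sum_mono min.mono) (auto simp: reps_dyson_transform[of A C])
      finally show ?thesis using cU by (simp add: i_def)
    next
      case False
      have le: "(t - i) * (card (A - C) + card (C - A) - (t - i))
          \<le> (\<Sum>x\<in>UNIV. min (t - i) (reps (A - C) (C - A) x))"
        using False iC i0 iA cA cB less.prems by (intro less.hyps) auto
      obtain m where m: "t = i + m" using False by (metis le_iff_add nat_le_linear)
      obtain n where n: "card A = t + n" using less.prems by (metis le_iff_add)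
      obtain q where q: "card B = t + q" using less.prems by (metis le_iff_add)
      have "t * (card A + card B - t)
          = card (A \<union> C) * i + (t - i) * (card (A - C) + card (C - A) - (t - i))"
      proof -
        have "card (A \<union> C) = i + 2 * m + n + q" using cU m n q by simp
        then show ?thesis unfolding cA cB n q m by (simp add: algebra_simps)
      qed
      also have "\<dots> \<le> (\<Sum>x\<in>UNIV. min i (reps (A \<union> C) (A \<inter> C) x))
          + (\<Sum>x\<in>UNIV. min (t - i) (reps (A - C) (C - A) x))"
        using full[of "A \<union> C" "A \<inter> C"] le by (simp add: i_def)
      \<comment> \<open>Pointwise,
        \<open>min i r + min (t - i) r' \<le> min t (r + r')\<close>.\<close>
      also have "\<dots> \<le> (\<Sum>x\<in>UNIV. min t (reps A C x))"
        unfolding sum.distrib[symmetric]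
        using False by (intro sum_mono) (auto simp: reps_dyson_transform[of A C])
      finally show ?thesis .
    qed
    then show ?thesis
      unfolding C_def sum_min_reps_translate .
  qed
qed

text \<open>Pollard's theorem at level 1 counts the elements of the sumset. When the sets are too
  large for it, \<open>A\<close> and \<open>x - B\<close> must meet for every \<open>x\<close>. Here
  \<open>C\<close> is any set containing the sumset, and \<open>m\<close> is any target below the
  usual bound.\<close>

lemma cauchy_davenport:
  fixes A B :: "'p::prime_card mod_ring set"
  assumes "A \<noteq> {}" "B \<noteq> {}" "m \<le> CARD('p)" "m < card A + card B"
    and sub: "\<And>a b. a \<in> A \<Longrightarrow> b \<in> B \<Longrightarrow> a + b \<in> C"
  shows "m \<le> card C"
proof (cases "card A + card B \<le> CARD('p) + 1")
  case True
  have pos: "1 \<le> card A" "1 \<le> card B" using assms(1,2) by (simp_all add: Suc_leI card_gt_0_iff)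
  have "m \<le> card A + card B - 1" using assms(4) by simp
  also have "\<dots> \<le> (\<Sum>x\<in>UNIV. min 1 (reps A B x))"
    using pollard[of 1 A B] pos True by simp
  also have "\<dots> \<le> (\<Sum>x\<in>UNIV. if x \<in> C then 1 else 0)"
  proof (rule sum_mono)
    fix x
    have "{v \<in> B. x - v \<in> A} = {}" if "x \<notin> C"
      using sub[of "x - v" v for v] that by force
    then show "min 1 (reps A B x) \<le> (if x \<in> C then 1 else 0)"
      by (auto simp: reps_def)
  qed
  also have "\<dots> = card C" by (simp add: sum.If_cases)
  finally show ?thesis .
next
  case False
  have "x \<in> C" for x
  proof (rule ccontr)
    assume x: "x \<notin> C"
    have "A \<inter> (-) x ` B = {}"
    proof (rule ccontr)
      assume "A \<inter> (-) x ` B \<noteq> {}"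
      then obtain b where "b \<in> B" "x - b \<in> A" by auto
      then show False using sub[of "x - b" b] x by simp
    qed
    then have "card A + card ((-) x ` B) = card (A \<union> (-) x ` B)"
      by (simp add: card_Un_disjoint)
    also have "\<dots> \<le> CARD('p)"
      using card_mono[of UNIV "A \<union> (-) x ` B"] by simp
    finally show False using False by (simp add: card_image inj_on_def)
  qed
  then have "C = UNIV" by auto
  then show ?thesis using assms(3) by simp
qed

section \<open>Sizes of shifts and their sublevel sets\<close>

lemma shift_0 [simp]: "shift A 0 = 0"
  unfolding shift_def by (simp add: card_eq_0_iff)

lemma shift_add_le:
  assumes "finite A"
  shows "shift A (x + y) \<le> shift A x + shift A y"
proof -
  let ?Y = "{w \<in> A. w + y \<notin> A}"
  have fin: "finite {u \<in> A. u + x \<notin> A}" "finite ?Y" using assms by auto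
  have "{u \<in> A. u + (x + y) \<notin> A} \<subseteq> {u \<in> A. u + x \<notin> A} \<union> (\<lambda>w. w - x) ` ?Y"
  proof
    fix u assume u: "u \<in> {u \<in> A. u + (x + y) \<notin> A}"
    show "u \<in> {u \<in> A. u + x \<notin> A} \<union> (\<lambda>w. w - x) ` ?Y"
      using u by (cases "u + x \<in> A") (auto simp: add.assoc intro!: image_eqI[of _ _ "u + x"])
  qed
  then have "shift A (x + y) \<le> card ({u \<in> A. u + x \<notin> A} \<union> (\<lambda>w. w - x) ` ?Y)"
    unfolding shift_def using fin by (intro card_mono) auto
  also have "\<dots> \<le> shift A x + card ((\<lambda>w. w - x) ` ?Y)"
    unfolding shift_def by (rule card_Un_le)
  also have "\<dots> \<le> shift A x + shift A y"
    unfolding shift_def using fin card_image_le by auto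
  finally show ?thesis .
qed

lemma reps_plus_shift:
  assumes "finite A"
  shows "reps A (uminus ` A) x + shift A x = card A"
proof -
  have "reps A (uminus ` A) x = card {u \<in> A. u + x \<in> A}"
    unfolding reps_def
    by (rule bij_betw_same_card[where f=uminus],
        rule bij_betw_byWitness[where f'=uminus]) (auto simp: add.commute)
  moreover have "card A = card ({u \<in> A. u + x \<in> A} \<union> {u \<in> A. u + x \<notin> A})"
    by (rule arg_cong[where f=card]) auto
  moreover have "\<dots> = card {u \<in> A. u + x \<in> A} + shift A x"
    unfolding shift_def using assms by (intro card_Un_disjoint) auto
  ultimately show ?thesis by simp
qed

text \<open>With \<open>T = card A - s\<close>, the truncated difference
  \<open>s - shift A x\<close> is the excess of the representation count over \<open>T\<close>.
  Pollard's theorem at level \<open>T\<close> leaves at most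
  \<open>(card A)^2 - T * (2 * card A - T) = s^2\<close> for the total excess.\<close>

lemma sum_shift_defect_le:
  fixes A :: "'p::prime_card mod_ring set"
  assumes "s \<le> card A" "card A + s \<le> CARD('p)"
  shows "(\<Sum>x\<in>UNIV. s - shift A x) \<le> s\<^sup>2"
proof -
  obtain T where T: "card A = s + T" using assms(1) by (metis le_iff_add)
  let ?r = "reps A (uminus ` A)"
  have neg: "card (uminus ` A) = card A" by (simp add: card_image)
  have "s - shift A x = ?r x - T" for x
    using reps_plus_shift[of A x] T by simp
  then have "(\<Sum>x\<in>UNIV. s - shift A x) + (\<Sum>x\<in>UNIV. min T (?r x)) = (\<Sum>x\<in>UNIV. ?r x)"
    unfolding sum.distrib[symmetric] by (intro sum.cong) auto
  also have "\<dots> = card A * card A" by (simp add: sum_reps neg)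
  finally have "(\<Sum>x\<in>UNIV. s - shift A x) + (\<Sum>x\<in>UNIV. min T (?r x)) = card A * card A" .
  moreover have "T * (card A + card A - T) \<le> (\<Sum>x\<in>UNIV. min T (?r x))"
    using pollard[of T A "uminus ` A"] assms T neg by simp
  ultimately show ?thesis using T by (simp add: power2_eq_square algebra_simps)
qed

text \<open>If \<open>m\<close> is the least index counted, there are at most
  \<open>t + 1 - m\<close> indices, and \<open>m * t \<ge> n\<close>. With
  \<open>n = shift A x\<close> this bounds how many sublevel sets contain \<open>x\<close>.\<close>

lemma layer_count_le:
  fixes t n :: nat
  shows "t * card {j \<in> {..t}. n \<le> j * t} \<le> t * (t + 1) - n"
proof (cases "{j \<in> {..t}. n \<le> j * t} = {}")
  case False
  define m where "m = Min {j \<in> {..t}. n \<le> j * t}"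
  have m: "m \<le> t" "n \<le> m * t"
    using Min_in[OF _ False] by (auto simp: m_def)
  have "{j \<in> {..t}. n \<le> j * t} \<subseteq> {m..t}" by (auto simp: m_def)
  then have "card {j \<in> {..t}. n \<le> j * t} \<le> t + 1 - m"
    using card_mono[of "{m..t}"] by force
  then have "t * card {j \<in> {..t}. n \<le> j * t} \<le> t * (t + 1 - m)" by simp
  also have "\<dots> = t * (t + 1) - t * m" by (rule diff_mult_distrib2)
  also have "\<dots> \<le> t * (t + 1) - n" using m by (simp add: mult.commute diff_le_mono2)
  finally show ?thesis .
qed (simp only: card.empty mult_0_right zero_le)

text \<open>Double counting of the pairs of \<open>j \<le> t\<close> and \<open>x\<close> in
  \<open>E j\<close>: counting by \<open>j\<close> uses the growth of \<open>E j\<close>, counting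
  by \<open>x\<close> uses \<open>layer_count_le\<close> and the defect bound.\<close>

lemma exists_large_shift:
  fixes A B :: "'p::prime_card mod_ring set"
  assumes "0 < t" "t * (t + 1) \<le> card A" "2 * card A < CARD('p)" "card B = t + 2"
  shows "\<exists>b\<in>B. \<exists>c\<in>B. t < shift A (b - c)"
proof (rule ccontr)
  assume "\<not> ?thesis"
  then have small: "shift A (b - c) \<le> t" if "b \<in> B" "c \<in> B" for b c
    using that by (meson not_le)
  define E where "E j = {x. shift A x \<le> j * t}" for j
  define D where "D = {x. shift A x \<le> t}"
  let ?s = "t * (t + 1)"
  have bound: "2 * ?s + 1 \<le> CARD('p)" using assms by simp
  have ne: "B \<noteq> {}" using assms(4) by auto
  \<comment> \<open>\<open>D\<close> contains all differences of \<open>B\<close>, and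
    \<open>2 * t + 3 = 2 * card B - 1\<close>.\<close>
  have D: "2 * t + 3 \<le> card D"
  proof (rule cauchy_davenport[of B "uminus ` B"])
    show "2 * t + 3 \<le> CARD('p)"
    proof -
      have "1 \<le> t * t" using assms(1) by (simp add: Suc_leI)
      moreover have "2 * t + 2 * (t * t) + 1 \<le> CARD('p)" using bound by (simp add: algebra_simps)
      ultimately show ?thesis by linarith
    qed
    show "2 * t + 3 < card B + card (uminus ` B)"
      using assms(4) by (simp add: card_image)
  qed (use ne small in \<open>auto simp: D_def\<close>)
  \<comment> \<open>By subadditivity \<open>E j + D\<close> lies in \<open>E (Suc j)\<close>, so
    each step gains \<open>card D - 1\<close>, at least \<open>2 * (t + 1)\<close>;
    \<open>bound\<close> keeps the targets within \<open>CARD('p)\<close>.\<close>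
  have E: "2 * (t + 1) * j + 1 \<le> card (E j)" if "j \<le> t" for j
    using that
  proof (induction j)
    case 0
    have "0 \<in> E 0" by (simp add: E_def)
    then show ?case by (auto simp: card_gt_0_iff Suc_le_eq)
  next
    case (Suc j)
    have "2 * (t + 1) * Suc j \<le> 2 * (t + 1) * t" using Suc.prems by (intro mult_le_mono2)
    then have "2 * (t + 1) * Suc j + 1 \<le> CARD('p)" using bound by (simp add: algebra_simps)
    moreover have "2 * (t + 1) * Suc j + 1 < card (E j) + card D"
      using Suc D by simp
    moreover have "x + y \<in> E (Suc j)" if "x \<in> E j" "y \<in> D" for x y
      using that shift_add_le[of A x y] by (auto simp: E_def D_def)
    moreover have "E j \<noteq> {}" "D \<noteq> {}"
      by (auto simp: E_def D_def intro!: exI[of _ 0])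
    ultimately show ?case by (intro cauchy_davenport[of "E j" D]) auto
  qed
  have gauss: "(\<Sum>j\<le>n. 2 * (t + 1) * j + 1) = (t + 1) * n * (n + 1) + (n + 1)" for n
    by (induction n) (simp_all add: algebra_simps)
  \<comment> \<open>The right-hand side equals \<open>?s^2 + ?s\<close>, so the contradiction has a
    margin of exactly \<open>?s\<close>.\<close>
  have "?s\<^sup>2 < t * (\<Sum>j\<le>t. 2 * (t + 1) * j + 1)"
    unfolding gauss using assms(1) by (simp add: power2_eq_square algebra_simps)
  also have "\<dots> \<le> t * (\<Sum>j\<le>t. card (E j))"
    using E by (intro mult_le_mono2 sum_mono) auto
  also have "(\<Sum>j\<le>t. card (E j)) = (\<Sum>j\<le>t. \<Sum>x\<in>UNIV. if shift A x \<le> j * t then 1 else 0)"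
    unfolding E_def by (simp add: sum.If_cases)
  also have "\<dots> = (\<Sum>x\<in>UNIV. \<Sum>j\<le>t. if shift A x \<le> j * t then 1 else 0)"
    by (rule sum.swap)
  also have "\<dots> = (\<Sum>x\<in>UNIV. card {j \<in> {..t}. shift A x \<le> j * t})"
    by (simp add: sum.If_cases Int_def)
  also have "t * \<dots> \<le> (\<Sum>x\<in>UNIV. ?s - shift A x)"
    unfolding sum_distrib_left by (intro sum_mono layer_count_le)
  also have "\<dots> \<le> ?s\<^sup>2"
    using assms by (intro sum_shift_defect_le) auto
  finally show False by simp
qed

section \<open>From a small restricted sumset to uniformly small shifts\<close>

theorem theorem5:
  fixes A B :: "'p::prime_card mod_ring set"
    and \<tau> :: "'p mod_ring \<Rightarrow> 'p mod_ring"
  assumes "A \<noteq> {}" and "B \<noteq> {}"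
    and "real (card A) < real CARD('p) / 2"
    and "real (card B) < sqrt (real (card A)) + 1"
    and "\<tau> \<in> B \<rightarrow> A"
  shows "int (card (restricted_sumset A \<tau> B)) \<ge> int (card A) + int (card B) - 3"
proof (rule ccontr)
  let ?S = "restricted_sumset A \<tau> B"
  let ?T = "\<lambda>b. (\<lambda>u. u + b) ` (A - {\<tau> b})"
  assume "\<not> ?thesis"
  then have S: "card ?S + 4 \<le> card A + card B" by linarith
  have sub: "?T b \<subseteq> ?S" if "b \<in> B" for b
    using that unfolding restricted_sumset_def by auto
  have cT: "card (?T b) = card A - 1" if "b \<in> B" for b
  proof -
    have "\<tau> b \<in> A" using that assms(5) by (rule funcset_mem[rotated])
    then show ?thesis by (simp add: card_image card_Diff_singleton)
  qed
  have T_le: "card A - 1 \<le> card ?S" if "b \<in> B" for b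
    using card_mono[OF _ sub[OF that]] cT[OF that] by simp
  define t where "t = card B - 2"
  have "card A - 1 \<le> card ?S" using T_le assms(2) by blast
  \<comment> \<open>This makes \<open>t\<close> positive and the natural subtraction in its
    definition exact.\<close>
  then have "2 < card B" using S by linarith
  then have B: "card B = t + 2" "0 < t" by (simp_all add: t_def)
  have "shift A (b - c) \<le> t" if bc: "b \<in> B" "c \<in> B" for b c
  proof -
    let ?X = "(\<lambda>u. u + b) ` {u \<in> A. u + (b - c) \<notin> A}"
    \<comment> \<open>\<open>?X\<close> is the part of \<open>A + b\<close> outside
      \<open>A + c\<close>. Only \<open>\<tau> b + b\<close> may fall outside \<open>?S\<close>, and
      removing \<open>?T c\<close> from \<open>?S\<close> takes away \<open>card A - 1\<close>
      elements, so at most \<open>1 + (card B - 3) = t\<close> remain.\<close>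
    have "?X \<subseteq> insert (\<tau> b + b) (?S - ?T c)"
    proof
      fix y assume "y \<in> ?X"
      then obtain u where u: "y = u + b" "u \<in> A" "u + (b - c) \<notin> A" by auto
      have "y \<notin> ?T c"
      proof
        assume "y \<in> ?T c"
        then obtain w where "w \<in> A" "u + b = w + c" using u(1) by auto
        then have "u + (b - c) = w" by (simp add: algebra_simps)
        then show False using u(3) \<open>w \<in> A\<close> by simp
      qed
      moreover have "y = \<tau> b + b \<or> y \<in> ?S"
        using u bc unfolding restricted_sumset_def by auto
      ultimately show "y \<in> insert (\<tau> b + b) (?S - ?T c)" by auto
    qed
    then have "card ?X \<le> card (insert (\<tau> b + b) (?S - ?T c))" by (intro card_mono) auto
    also have "\<dots> \<le> Suc (card (?S - ?T c))" by (rule card_insert_le_m1) auto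
    also have "card (?S - ?T c) = card ?S - (card A - 1)"
      using sub[OF bc(2)] cT[OF bc(2)] by (simp add: card_Diff_subset)
    finally have "card ?X \<le> t" using S B by simp
    then show ?thesis by (simp add: shift_def card_image)
  qed
  moreover have "t * (t + 1) \<le> card A"
  proof -
    have "real (t + 1) < sqrt (real (card A))" using assms(4) B by simp
    then have "(real (t + 1))\<^sup>2 < real (card A)"
      using power_strict_mono[of "real (t + 1)" "sqrt (real (card A))" 2] by simp
    then have "(t + 1)\<^sup>2 < card A" by (simp only: of_nat_power[symmetric] of_nat_less_iff)
    then show ?thesis by (simp add: power2_eq_square)
  qed
  moreover have "2 * card A < CARD('p)" using assms(3) by linarith
  ultimately show False using exists_large_shift[of t A B] B by (meson not_le)
qed

end
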